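(* Let $X$ be a real Hilbert space, let $R\colon X\to X$ be linear and nonexpansive (i.e., $\|Rx-Ry\|\le\|x-y\|$ for all $x,y\in X$), set $D:=\operatorname{Fix}R=\ker(\mathrm{Id}-R)$, and suppose that $\operatorname{ran}(\mathrm{Id}-R)$ is closed. Set $$T:=P_{D^\perp}(\mathrm{Id}-R)^{-1}P_{D^\perp}-\tfrac12P_{D^\perp}.$$ Then the following hold: (i) $\frac12\mathrm{Id}+T$ is $\frac12$-strongly monotone. (ii) $\big(\frac12\mathrm{Id}+T\big)^{-1}=2J_{2T}$. (iii) $2T+\mathrm{Id}=2P_{D^\perp}(\mathrm{Id}-R)^{-1}P_{D^\perp}+P_D$. (iv) $J_{2T}=P_D+\frac12(\mathrm{Id}-R)P_{D^\perp}$. (v) $2J_{2T}=(\mathrm{Id}-R)P_{D^\perp}+2P_D$. (vi) $(\mathrm{Id}-R)P_{D^\perp}+2P_D=\mathrm{Id}-R+2P_D$. (vii) $\big(\frac12\mathrm{Id}+T\big)^{-1}=2J_{2T}=(\mathrm{Id}-R)P_{D^\perp}+2P_D=\mathrm{Id}-R+2P_D$. (viii) $\big(\frac12\mathrm{Id}+T\big)^{-1}\big|_{D^\perp}=\mathrm{Id}-R$, i.e., $\big(\frac12\mathrm{Id}+T\big)^{-1}y=y-Ry$ for all $y\in D^\perp$.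
   Context: $\mathrm{Id}$ is the identity on $X$; $P_C$ is the orthogonal projection onto a closed linear subspace $C$; $(\mathrm{Id}-R)^{-1}\colon X\rightrightarrows X$ is the set-valued inverse, $(\mathrm{Id}-R)^{-1}y=\{x\in X: x-Rx=y\}$. Compositions are those of set-valued operators, so $P_{D^\perp}(\mathrm{Id}-R)^{-1}P_{D^\perp}z=\{P_{D^\perp}x: x-Rx=P_{D^\perp}z\}$; when $\operatorname{ran}(\mathrm{Id}-R)$ is closed it equals $D^\perp$ and these values are singletons, so $T$ is regarded as a map $X\to X$. The resolvent of an operator $M$ is $J_M=(\mathrm{Id}+M)^{-1}$, so $J_{2T}=(\mathrm{Id}+2T)^{-1}$. A map $M\colon X\to X$ is $\beta$-strongly monotone ($\beta>0$) if $\langle x-y,Mx-My\rangle\ge\beta\|x-y\|^2$ for all $x,y\in X$. *)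

theory Defs
  imports "HOL-Analysis.Analysis"
begin

(* Set-valued operators are functions into sets; the operator has the empty value
   outside of its domain. *)
type_synonym ('a, 'b) sv_op = "'a \<Rightarrow> 'b set"

definition sv_of :: "('a \<Rightarrow> 'b) \<Rightarrow> ('a, 'b) sv_op" where
  "sv_of f = (\<lambda>x. {f x})"

(* The map underlying a single-valued operator; a value A x that is not a singleton
   gives an unspecified result. *)
definition sv_map :: "('a, 'b) sv_op \<Rightarrow> 'a \<Rightarrow> 'b" where
  "sv_map A = (\<lambda>x. the_elem (A x))"

definition sv_inv :: "('a, 'b) sv_op \<Rightarrow> ('b, 'a) sv_op" where
  "sv_inv A = (\<lambda>y. {x. y \<in> A x})"

definition sv_comp :: "('b, 'c) sv_op \<Rightarrow> ('a, 'b) sv_op \<Rightarrow> ('a, 'c) sv_op" where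
  "sv_comp A B = (\<lambda>x. \<Union>y\<in>B x. A y)"

definition sv_add :: "('a, 'b::plus) sv_op \<Rightarrow> ('a, 'b) sv_op \<Rightarrow> ('a, 'b) sv_op" where
  "sv_add A B = (\<lambda>x. {u + v | u v. u \<in> A x \<and> v \<in> B x})"

definition sv_scale :: "real \<Rightarrow> ('a, 'b::real_vector) sv_op \<Rightarrow> ('a, 'b) sv_op" where
  "sv_scale c A = (\<lambda>x. (\<lambda>u. c *\<^sub>R u) ` A x)"

definition resolvent :: "('a, 'a::plus) sv_op \<Rightarrow> ('a, 'a) sv_op" where
  "resolvent M = sv_inv (sv_add (sv_of (\<lambda>x. x)) M)"

(* The library's closest_point is restricted to Heine-Borel (hence finite-dimensional)
   spaces. For a closed subspace C of a Hilbert space the point p below exists and is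
   unique. *)
definition orth_proj :: "'a::real_inner set \<Rightarrow> 'a \<Rightarrow> 'a" where
  "orth_proj C x = (THE p. p \<in> C \<and> x - p \<in> C\<^sup>\<bottom>)"

definition strongly_monotone :: "real \<Rightarrow> ('a::real_inner \<Rightarrow> 'a) \<Rightarrow> bool" where
  "strongly_monotone \<beta> M \<longleftrightarrow>
     \<beta> > 0 \<and> (\<forall>x y. inner (x - y) (M x - M y) \<ge> \<beta> * (norm (x - y))\<^sup>2)"

(* The operator P (Id - R)^{-1} P with P the projection onto the orthogonal complement
   of D; its value at z is {P x | x. x - R x = P z}. *)
definition compressed_inv ::
    "'a set \<Rightarrow> ('a::real_inner \<Rightarrow> 'a) \<Rightarrow> ('a, 'a) sv_op" where
  "compressed_inv D R =
     sv_comp (sv_of (orth_proj (D\<^sup>\<bottom>)))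
       (sv_comp (sv_inv (sv_of (\<lambda>x. x - R x))) (sv_of (orth_proj (D\<^sup>\<bottom>))))"

definition T_op :: "'a set \<Rightarrow> ('a::real_inner \<Rightarrow> 'a) \<Rightarrow> ('a, 'a) sv_op" where
  "T_op D R =
     sv_add (compressed_inv D R) (sv_scale (- (1/2)) (sv_of (orth_proj (D\<^sup>\<bottom>))))"

end

(* The range V of Id - R is a closed subspace. Nonexpansiveness gives V \<subseteq> D\<^sup>\<bottom>
   (perturb x by multiples of d \<in> D) and V\<^sup>\<bottom> \<subseteq> D (equality in Cauchy-Schwarz),
   so the projection theorem for V yields X = V + D and V = D\<^sup>\<bottom>. Hence Id - R is a bijection
   of D\<^sup>\<bottom> onto itself; its inverse, composed with the projection P onto D\<^sup>\<bottom>,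
   is the compressed inverse, and x/2 + Tx is this map plus half the projection onto D.
   Strong monotonicity comes from \<langle>u - Ru, u\<rangle> \<ge> |u - Ru|^2 / 2. *)
theory Submission
  imports Defs
begin

section \<open>Projection onto a closed subspace of a Hilbert space\<close>

text \<open>For small \<open>t\<close> the linear term would dominate and make the expression
  negative for one sign of \<open>t\<close>. This is the first-order condition at a nearest
  point.\<close>

lemma inner_eq_0_if_quadratic_nonneg:
  fixes z v :: "'a::real_inner"
  assumes "\<And>t. 0 \<le> t\<^sup>2 * b - 2 * t * inner z v"
  shows "inner z v = 0"
proof (rule ccontr)
  define a where "a = inner z v"
  assume "inner z v \<noteq> 0"
  then have a: "a \<noteq> 0" by (simp add: a_def)
  \<comment> \<open>The minimiser would be \<open>a / b\<close>, but \<open>b\<close> may be zero or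
    negative. With \<open>\<bar>b\<bar> + 1\<close> instead, the quadratic is at most
    \<open>- (t * a)\<close>, which is negative.\<close>
  define t where "t = a / (\<bar>b\<bar> + 1)"
  have t: "t * (\<bar>b\<bar> + 1) = a" by (simp add: t_def)
  have "t \<noteq> 0" using t a by auto
  have "t\<^sup>2 * b \<le> t\<^sup>2 * (\<bar>b\<bar> + 1)"
    by (intro mult_left_mono) auto
  also have "\<dots> = t * a" by (simp add: t[symmetric] power2_eq_square algebra_simps)
  finally have "0 \<le> - (t * a)" using assms[of t] by (simp add: a_def algebra_simps)
  moreover have "t * a = t\<^sup>2 * (\<bar>b\<bar> + 1)" by (simp add: t[symmetric] power2_eq_square algebra_simps)
  moreover have "t\<^sup>2 * (\<bar>b\<bar> + 1) > 0" using \<open>t \<noteq> 0\<close> by (intro mult_pos_pos) auto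
  ultimately show False by simp
qed

text \<open>The parallelogram law for \<open>x - u\<close> and \<open>x - v\<close>, solved for the
  distance of \<open>u\<close> and \<open>v\<close>: two near-minimisers are close because their
  midpoint cannot beat the infimum.\<close>

lemma parallelogram_midpoint:
  fixes x u v :: "'a::real_inner"
  shows "(norm (u - v))\<^sup>2 = 2 * (norm (x - u))\<^sup>2 + 2 * (norm (x - v))\<^sup>2
           - 4 * (norm (x - (1/2) *\<^sub>R (u + v)))\<^sup>2"
  by (simp add: power2_norm_eq_inner inner_diff_left inner_diff_right inner_add_left inner_add_right
      inner_commute algebra_simps)

text \<open>Cantor's intersection theorem for the sets of near-minimisers: they are closed, nonempty
  and decreasing, and their diameters tend to 0. The common point attains the distance.\<close>

lemma closed_subspace_nearest_point:
  fixes V :: "'a::{real_inner, complete_space} set"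
  assumes V: "subspace V" and cl: "closed V"
  obtains a where "a \<in> V" "\<And>v. v \<in> V \<Longrightarrow> norm (x - a) \<le> norm (x - v)"
proof -
  define d where "d = infdist x V"
  \<comment> \<open>Squared distances fit the parallelogram law. \<open>Suc\<close> keeps the slack
    positive at \<open>n = 0\<close>, so that nonemptiness follows from the infimum alone.\<close>
  define S where "S n = {v \<in> V. (norm (x - v))\<^sup>2 \<le> d\<^sup>2 + 1 / real (Suc n)}" for n
  have ne: "V \<noteq> {}" using V subspace_0 by blast
  have d: "0 \<le> d" "\<And>v. v \<in> V \<Longrightarrow> d \<le> norm (x - v)"
    by (auto simp: d_def infdist_nonneg infdist_le simp flip: dist_norm)
  have "\<exists>a. \<forall>n. a \<in> S n"
  proof (rule decreasing_closed_nest)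
    fix n
    have "closed {v. (norm (x - v))\<^sup>2 \<le> d\<^sup>2 + 1 / real (Suc n)}"
      by (intro closed_Collect_le continuous_intros)
    then show "closed (S n)"
      using cl by (simp add: S_def Collect_conj_eq closed_Int)
    have "d < sqrt (d\<^sup>2 + 1 / real (Suc n))"
      by (rule real_less_rsqrt) simp
    then have "\<exists>v\<in>V. dist x v < sqrt (d\<^sup>2 + 1 / real (Suc n))"
      using ne unfolding d_def infdist_notempty[OF ne]
      by (subst (asm) cINF_less_iff) auto
    then obtain v where v: "v \<in> V" "norm (x - v) < sqrt (d\<^sup>2 + 1 / real (Suc n))"
      by (auto simp: dist_norm)
    then have "(norm (x - v))\<^sup>2 \<le> (sqrt (d\<^sup>2 + 1 / real (Suc n)))\<^sup>2"
      by (intro power_mono) auto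
    then show "S n \<noteq> {}" using v(1) by (auto simp: S_def)
  next
    fix m n :: nat assume "m \<le> n"
    then have "1 / real (Suc n) \<le> 1 / real (Suc m)" by (simp add: frac_le)
    then show "S n \<subseteq> S m" by (fastforce simp: S_def)
  next
    fix e :: real assume e: "0 < e"
    \<comment> \<open>The parallelogram law bounds the squared distance of two points of
      \<open>S n\<close> by \<open>4 / real (Suc n)\<close>.\<close>
    obtain n where n: "1 / real (Suc n) < e\<^sup>2 / 4"
      using nat_approx_posE[of "e\<^sup>2 / 4"] e by auto
    have "dist u v < e" if "u \<in> S n" "v \<in> S n" for u v
    proof -
      have "(1/2) *\<^sub>R (u + v) \<in> V"
        using that V by (auto simp: S_def intro: subspace_scale subspace_add)
      then have "d\<^sup>2 \<le> (norm (x - (1/2) *\<^sub>R (u + v)))\<^sup>2"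
        using d by (intro power_mono) auto
      then have "(norm (u - v))\<^sup>2 < e\<^sup>2"
        using that n unfolding parallelogram_midpoint[of u v x] by (auto simp: S_def)
      then show ?thesis using e by (simp add: dist_norm power_less_imp_less_base)
    qed
    then show "\<exists>n. \<forall>u\<in>S n. \<forall>v\<in>S n. dist u v < e" by blast
  qed blast
  then obtain a where a: "\<And>n. a \<in> S n" by blast
  have "(norm (x - a))\<^sup>2 \<le> d\<^sup>2"
  proof (rule field_le_epsilon)
    fix e :: real assume "0 < e"
    then obtain n where "1 / real (Suc n) < e" using nat_approx_posE by blast
    moreover have "(norm (x - a))\<^sup>2 \<le> d\<^sup>2 + 1 / real (Suc n)"
      using a[of n] unfolding S_def by blast
    ultimately show "(norm (x - a))\<^sup>2 \<le> d\<^sup>2 + e" by linarith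
  qed
  then have "norm (x - a) \<le> d" using d(1) by (rule power2_le_imp_le)
  then have "norm (x - a) \<le> norm (x - v)" if "v \<in> V" for v
    using d(2)[OF that] by linarith
  moreover have "a \<in> V" using a[of 0] unfolding S_def by blast
  ultimately show thesis using that by blast
qed

text \<open>Moving the nearest point \<open>a\<close> along \<open>v\<close> does not decrease the
  distance to \<open>x\<close>, which makes \<open>x - a\<close> orthogonal to
  \<open>v\<close>.\<close>

lemma closed_subspace_decomp:
  fixes V :: "'a::{real_inner, complete_space} set"
  assumes V: "subspace V" and cl: "closed V"
  obtains a where "a \<in> V" "x - a \<in> V\<^sup>\<bottom>"
proof -
  obtain a where a: "a \<in> V" "\<And>v. v \<in> V \<Longrightarrow> norm (x - a) \<le> norm (x - v)"
    using closed_subspace_nearest_point[OF V cl] by metis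
  have "inner (x - a) v = 0" if "v \<in> V" for v
  proof (rule inner_eq_0_if_quadratic_nonneg)
    fix t
    have "norm (x - a) \<le> norm (x - (a + t *\<^sub>R v))"
      using that a V by (intro a(2)) (auto intro: subspace_add subspace_scale)
    then have "(norm (x - a))\<^sup>2 \<le> (norm ((x - a) - t *\<^sub>R v))\<^sup>2"
      by (intro power_mono) (auto simp: algebra_simps)
    also have "\<dots> = (norm (x - a))\<^sup>2 + (t\<^sup>2 * (norm v)\<^sup>2 - 2 * t * inner (x - a) v)"
      by (simp only: power2_norm_eq_inner)
        (simp add: inner_diff_left inner_diff_right inner_commute power2_eq_square algebra_simps)
    finally show "0 \<le> t\<^sup>2 * (norm v)\<^sup>2 - 2 * t * inner (x - a) v" by simp
  qed
  then have "x - a \<in> V\<^sup>\<bottom>"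
    by (auto simp: orthogonal_comp_def orthogonal_def inner_commute)
  then show thesis using that a(1) by blast
qed

text \<open>Two candidates differ by a vector of \<open>C\<close> that is orthogonal to itself, so
  the definite description is determined.\<close>

lemma orth_proj_eqI:
  assumes C: "subspace C" and p: "p \<in> C" "x - p \<in> C\<^sup>\<bottom>"
  shows "orth_proj C x = p"
  unfolding orth_proj_def
proof (rule the_equality)
  fix q assume q: "q \<in> C \<and> x - q \<in> C\<^sup>\<bottom>"
  have "q - p \<in> C" using C p q by (simp add: subspace_diff)
  moreover have "(x - p) - (x - q) \<in> C\<^sup>\<bottom>"
    using p q subspace_orthogonal_comp subspace_diff by blast
  then have "q - p \<in> C\<^sup>\<bottom>" by simp
  ultimately have "inner (q - p) (q - p) = 0"
    unfolding orthogonal_comp_def orthogonal_def by blast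
  then show "q = p" by simp
qed (use p in simp)

lemma sv_add_of: "sv_add (sv_of f) (sv_of g) = sv_of (\<lambda>x. f x + g x)"
  by (simp add: sv_add_def sv_of_def)

lemma sv_scale_of: "sv_scale c (sv_of f) = sv_of (\<lambda>x. c *\<^sub>R f x)"
  by (simp add: sv_scale_def sv_of_def)

section \<open>Fixed points and residuals of a nonexpansive linear map\<close>

locale nonexpansive_linear =
  fixes R :: "'a::real_inner \<Rightarrow> 'a"
  assumes lin: "linear R"
    and norm_le: "\<And>x. norm (R x) \<le> norm x"
begin

definition D where "D = {x. R x = x}"

lemma subspace_D: "subspace D"
  unfolding D_def subspace_def
  by (auto simp: linear_0 linear_add linear_scale lin)

text \<open>Expand \<open>R u = u - (u - R u)\<close> in \<open>norm (R u) \<le> norm u\<close>;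
  this is 1/2-cocoercivity of Id - R.\<close>

lemma inner_residual_ge: "(norm (u - R u))\<^sup>2 / 2 \<le> inner u (u - R u)"
proof -
  have "(norm (R u))\<^sup>2 \<le> (norm u)\<^sup>2" using norm_le by (simp add: power_mono)
  then show ?thesis
    by (simp add: power2_norm_eq_inner inner_diff_left inner_diff_right inner_commute field_simps)
qed

text \<open>Since \<open>R\<close> fixes \<open>d\<close>, the quadratic terms cancel when the norms
  of \<open>x - t *\<^sub>R d\<close> and its image are compared. What remains is affine in
  \<open>t\<close> and nonnegative for all \<open>t\<close>, so its slope vanishes.\<close>

lemma residual_in_comp: "x - R x \<in> D\<^sup>\<bottom>"
proof -
  have "inner (x - R x) d = 0" if "d \<in> D" for d
  proof -
    have Rd: "R d = d" using that by (simp add: D_def)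
    have "0 \<le> t\<^sup>2 * 0 - 2 * t * inner (x - R x) d + ((norm x)\<^sup>2 - (norm (R x))\<^sup>2)" for t
    proof -
      have "(norm (R (x - t *\<^sub>R d)))\<^sup>2 \<le> (norm (x - t *\<^sub>R d))\<^sup>2"
        using norm_le by (simp add: power_mono)
      then show ?thesis
        by (simp add: linear_diff linear_scale lin Rd power2_norm_eq_inner inner_diff_left
            inner_diff_right inner_commute algebra_simps)
    qed
    note ge = this
    \<comment> \<open>At this \<open>t\<close> the affine expression equals -1.\<close>
    from ge[of "((norm x)\<^sup>2 - (norm (R x))\<^sup>2 + 1) / (2 * inner (x - R x) d)"]
    show ?thesis by (cases "inner (x - R x) d = 0") auto
  qed
  then show ?thesis by (auto simp: orthogonal_comp_def orthogonal_def inner_commute)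
qed

text \<open>Such a \<open>w\<close> is orthogonal to its own residual, and cocoercivity then makes
  the residual zero.\<close>

lemma range_comp_subset: "(range (\<lambda>x. x - R x))\<^sup>\<bottom> \<subseteq> D"
proof
  fix w assume "w \<in> (range (\<lambda>x. x - R x))\<^sup>\<bottom>"
  then have "inner w (w - R w) = 0"
    by (auto simp: orthogonal_comp_def orthogonal_def inner_commute)
  then have "(norm (w - R w))\<^sup>2 \<le> 0" using inner_residual_ge[of w] by simp
  then show "w \<in> D" by (simp add: D_def)
qed

lemma D_Int_comp: "x \<in> D \<Longrightarrow> x \<in> D\<^sup>\<bottom> \<Longrightarrow> x = 0"
  by (auto simp: orthogonal_comp_def orthogonal_def)

end

section \<open>Closed range: orthogonal splitting and inversion of the residual\<close>

locale nonexpansive_linear_closed_range = nonexpansive_linear R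
  for R :: "'a::{real_inner, complete_space} \<Rightarrow> 'a" +
  assumes closed_range: "closed (range (\<lambda>x. x - R x))"
begin

abbreviation P where "P \<equiv> orth_proj D"
abbreviation Q where "Q \<equiv> orth_proj (D\<^sup>\<bottom>)"

text \<open>Projecting onto the range leaves a remainder in its orthogonal complement, hence in
  \<open>D\<close>. Closedness of the range enters here.\<close>

lemma range_decomp: obtains y where "x - (y - R y) \<in> D"
proof -
  have "linear (\<lambda>x. x - R x)"
    using lin linear_compose_sub linear_ident by blast
  then have "subspace (range (\<lambda>x. x - R x))"
    using linear_subspace_image subspace_UNIV by blast
  then show thesis
    using closed_subspace_decomp[OF _ closed_range, of x] range_comp_subset that by auto
qed

text \<open>One splitting of \<open>x\<close> yields both projections; for \<open>Q\<close> this
  uses that \<open>D\<close> lies in its double complement.\<close>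

lemma proj_eqI:
  assumes "q \<in> D\<^sup>\<bottom>" "x - q \<in> D"
  shows "Q x = q" "P x = x - q"
  using assms subspace_D subspace_orthogonal_comp orthogonal_comp_subset[of D]
  by (auto intro!: orth_proj_eqI)

lemma Q_in [simp]: "Q x \<in> D\<^sup>\<bottom>" and P_eq: "P x = x - Q x" and P_in [simp]: "P x \<in> D"
  using range_decomp[of x] residual_in_comp proj_eqI by metis+

lemma Q_diff: "Q (x - y) = Q x - Q y"
proof (rule proj_eqI)
  show "Q x - Q y \<in> D\<^sup>\<bottom>" by (simp add: subspace_diff subspace_orthogonal_comp)
  have "P x - P y \<in> D" by (simp add: subspace_diff subspace_D)
  then show "x - y - (Q x - Q y) \<in> D" by (simp add: P_eq algebra_simps)
qed

lemma P_scale: "P (c *\<^sub>R x) = c *\<^sub>R P x"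
proof -
  have "c *\<^sub>R P x \<in> D" by (simp add: subspace_scale subspace_D)
  then have "P (c *\<^sub>R x) = c *\<^sub>R x - c *\<^sub>R Q x"
    by (intro proj_eqI) (simp_all add: P_eq subspace_scale subspace_orthogonal_comp scaleR_diff_right)
  then show ?thesis by (simp add: P_eq scaleR_diff_right)
qed

lemma R_P: "R (P x) = P x"
  using P_in[of x] by (simp add: D_def)

text \<open>\<open>x\<close> and \<open>Q x\<close> differ by the fixed point
  \<open>P x\<close>.\<close>

lemma residual_Q: "Q x - R (Q x) = x - R x"
proof -
  have "R (x - Q x) = x - Q x" using R_P[of x] by (simp add: P_eq)
  then show ?thesis by (simp add: linear_diff lin algebra_simps)
qed

text \<open>The range part of the splitting of \<open>z\<close> is a residual and equals
  \<open>Q z\<close>, so the set-valued inverse is nonempty at \<open>Q z\<close>.\<close>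

lemma Q_surj_residual: "\<exists>x. x - R x = Q z"
  using range_decomp[of z] residual_in_comp proj_eqI(1) by metis

lemma residual_inj:
  assumes "u \<in> D\<^sup>\<bottom>" "v \<in> D\<^sup>\<bottom>" "u - R u = v - R v"
  shows "u = v"
proof -
  have "u - v \<in> D" using assms(3) by (simp add: D_def linear_diff lin algebra_simps)
  moreover have "u - v \<in> D\<^sup>\<bottom>" using assms by (simp add: subspace_diff subspace_orthogonal_comp)
  ultimately show ?thesis using D_Int_comp by fastforce
qed

text \<open>The choice is harmless: two preimages of \<open>Q z\<close> differ by an element of
  \<open>D\<close>, which \<open>Q\<close> removes. \<open>S\<close> is the inverse of Id - R on
  \<open>D\<^sup>\<bottom>\<close>, applied after \<open>Q\<close>.\<close>

definition S where "S z = Q (SOME x. x - R x = Q z)"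

lemma S_in [simp]: "S z \<in> D\<^sup>\<bottom>" and S_residual: "S z - R (S z) = Q z"
  using someI_ex[OF Q_surj_residual, of z] by (simp_all add: S_def residual_Q)

lemma S_eqI: "u \<in> D\<^sup>\<bottom> \<Longrightarrow> u - R u = Q z \<Longrightarrow> S z = u"
  by (rule residual_inj) (simp_all add: S_residual)

text \<open>Some preimage of \<open>Q z\<close> exists, and all preimages have the same projection
  \<open>S z\<close>. Hence T is single-valued.\<close>

lemma compressed_inv_eq: "compressed_inv D R = sv_of S"
proof
  fix z
  have "Q x = S z" if "x - R x = Q z" for x
    using that by (intro S_eqI[symmetric]) (simp_all add: residual_Q)
  then have "{Q x | x. x - R x = Q z} = {S z}"
    using Q_surj_residual[of z] by force
  then show "compressed_inv D R z = sv_of S z"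
    by (simp add: compressed_inv_def sv_comp_def sv_of_def sv_inv_def set_eq_iff) metis
qed

lemma T_op_eq: "T_op D R = sv_of (\<lambda>x. S x - (1/2) *\<^sub>R Q x)"
  by (simp add: T_op_def compressed_inv_eq sv_add_of sv_scale_of)

section \<open>Strong monotonicity and the inverse formulas\<close>

lemma half_plus_T: "(1/2) *\<^sub>R x + (S x - (1/2) *\<^sub>R Q x) = S x + (1/2) *\<^sub>R P x"
  by (simp add: P_eq algebra_simps)

lemma S_diff: "S (x - y) = S x - S y"
proof (rule S_eqI)
  show "S x - S y \<in> D\<^sup>\<bottom>" by (simp add: subspace_diff subspace_orthogonal_comp)
  have "S x - S y - R (S x - S y) = (S x - R (S x)) - (S y - R (S y))"
    by (simp add: linear_diff lin algebra_simps)
  then show "S x - S y - R (S x - S y) = Q (x - y)" by (simp add: S_residual Q_diff)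
qed

lemma inner_P_comp: "u \<in> D\<^sup>\<bottom> \<Longrightarrow> inner (P x) u = 0"
  using P_in[of x] by (auto simp: orthogonal_comp_def orthogonal_def)

text \<open>Additivity reduces the claim to one vector, which splits orthogonally: the
  \<open>P\<close> part contributes exactly half its squared norm, and the \<open>Q\<close> part is
  cocoercivity at \<open>S x\<close>, whose residual is \<open>Q x\<close>.\<close>

lemma strongly_monotone_S_P: "strongly_monotone (1/2) (\<lambda>x. S x + (1/2) *\<^sub>R P x)"
proof -
  have bound: "(norm x)\<^sup>2 / 2 \<le> inner x (S x + (1/2) *\<^sub>R P x)" for x
  proof -
    have x: "x = Q x + P x" by (simp add: P_eq)
    have QP: "inner (P x) (Q x) = 0" "inner (P x) (S x) = 0" by (simp_all add: inner_P_comp)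
    have "(norm x)\<^sup>2 = (norm (Q x))\<^sup>2 + (norm (P x))\<^sup>2"
      using QP by (subst x) (simp add: power2_norm_eq_inner inner_add_left inner_add_right inner_commute)
    moreover have "inner x (S x + (1/2) *\<^sub>R P x) = inner (S x) (Q x) + (norm (P x))\<^sup>2 / 2"
      using QP by (subst x) (simp add: power2_norm_eq_inner inner_add_left inner_add_right inner_commute)
    moreover have "(norm (Q x))\<^sup>2 / 2 \<le> inner (S x) (Q x)"
      using inner_residual_ge[of "S x"] by (simp add: S_residual)
    ultimately show ?thesis by (simp add: field_simps)
  qed
  have "S (x - y) + (1/2) *\<^sub>R P (x - y) = (S x + (1/2) *\<^sub>R P x) - (S y + (1/2) *\<^sub>R P y)" for x y
    by (simp add: S_diff P_eq Q_diff algebra_simps)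
  then show ?thesis
    using bound by (simp add: strongly_monotone_def) metis
qed

text \<open>Compare components: the left side says \<open>Q y = S x\<close> and
  \<open>P y = (1/2) *\<^sub>R P x\<close>, the right side says \<open>Q x = y - R y\<close> and
  \<open>P x = 2 *\<^sub>R P y\<close>. Applying Id - R or its inverse on
  \<open>D\<^sup>\<bottom>\<close> links the two.\<close>

lemma S_P_eq_iff: "y = S x + (1/2) *\<^sub>R P x \<longleftrightarrow> x = y - R y + 2 *\<^sub>R P y"
proof
  assume y: "y = S x + (1/2) *\<^sub>R P x"
  have "y - S x \<in> D" using y by (simp add: subspace_scale subspace_D)
  then have "Q y = S x" "P y = y - S x" by (simp_all add: proj_eqI)
  then show "x = y - R y + 2 *\<^sub>R P y"
    using S_residual[of x] residual_Q[of y] y by (simp add: P_eq)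
next
  assume x: "x = y - R y + 2 *\<^sub>R P y"
  have "x - (y - R y) \<in> D" using x by (simp add: subspace_scale subspace_D)
  then have "Q x = y - R y" "P x = x - (y - R y)" by (simp_all add: proj_eqI residual_in_comp)
  moreover from this have "S x = Q y" by (intro S_eqI) (simp_all add: residual_Q)
  ultimately show "y = S x + (1/2) *\<^sub>R P x"
    using x by (simp add: P_eq)
qed

lemma inv_half_plus_T:
  "sv_inv (sv_of (\<lambda>x. (1/2) *\<^sub>R x + (S x - (1/2) *\<^sub>R Q x))) = sv_of (\<lambda>y. y - R y + 2 *\<^sub>R P y)"
  unfolding half_plus_T by (auto simp: sv_inv_def sv_of_def S_P_eq_iff)

lemma residual_plus_proj:
  "P x + (1/2) *\<^sub>R (Q x - R (Q x)) = (1/2) *\<^sub>R (x - R x + 2 *\<^sub>R P x)"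
  by (simp add: residual_Q scaleR_add_right)

text \<open>Id + 2T is twice Id/2 + T, so the resolvent at \<open>y\<close> is the inverse of Id/2 +
  T at \<open>y\<close> halved.\<close>

lemma resolvent_2T:
  "resolvent (sv_of (\<lambda>x. 2 *\<^sub>R (S x - (1/2) *\<^sub>R Q x)))
     = sv_of (\<lambda>x. P x + (1/2) *\<^sub>R (Q x - R (Q x)))"
proof -
  have "y = x + 2 *\<^sub>R (S x - (1/2) *\<^sub>R Q x) \<longleftrightarrow> x = P y + (1/2) *\<^sub>R (Q y - R (Q y))" for x y
  proof -
    have "x + 2 *\<^sub>R (S x - (1/2) *\<^sub>R Q x) = 2 *\<^sub>R (S x + (1/2) *\<^sub>R P x)"
      by (simp add: P_eq algebra_simps)
    then have "y = x + 2 *\<^sub>R (S x - (1/2) *\<^sub>R Q x) \<longleftrightarrow> (1/2) *\<^sub>R y = S x + (1/2) *\<^sub>R P x"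
      using scaleR_cancel_left[of 2 "(1/2) *\<^sub>R y" "S x + (1/2) *\<^sub>R P x"] by simp
    also have "\<dots> \<longleftrightarrow> x = (1/2) *\<^sub>R y - R ((1/2) *\<^sub>R y) + 2 *\<^sub>R P ((1/2) *\<^sub>R y)"
      by (rule S_P_eq_iff)
    also have "\<dots> \<longleftrightarrow> x = P y + (1/2) *\<^sub>R (Q y - R (Q y))"
      by (simp add: residual_Q P_scale linear_scale lin scaleR_diff_right add.commute)
    finally show ?thesis .
  qed
  then show ?thesis
    by (auto simp: resolvent_def sv_inv_def sv_of_def sv_add_def)
qed

end

text \<open>The first conjunct certifies that every value of the set-valued T is a singleton, so
  that \<open>sv_map\<close> returns a meaningful map.\<close>

theorem theorem2p10:
  fixes R T :: "'a::{real_inner, complete_space} \<Rightarrow> 'a"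
    and D :: "'a set"
  assumes lin: "linear R"
    and nonexp: "\<And>x y. norm (R x - R y) \<le> norm (x - y)"
    and D: "D = {x. R x = x}"
    and ran: "closed (range (\<lambda>x. x - R x))"
    and T: "T = sv_map (T_op D R)"
  shows
    "   (T_op D R = sv_of T)
     \<and> (strongly_monotone (1/2) (\<lambda>x. (1/2) *\<^sub>R x + T x))
     \<and> (sv_inv (sv_of (\<lambda>x. (1/2) *\<^sub>R x + T x))
           = sv_scale 2 (resolvent (sv_of (\<lambda>x. 2 *\<^sub>R T x))))
     \<and> (sv_of (\<lambda>x. 2 *\<^sub>R T x + x)
           = sv_add (sv_scale 2 (compressed_inv D R)) (sv_of (orth_proj D)))
     \<and> (resolvent (sv_of (\<lambda>x. 2 *\<^sub>R T x))
           = sv_of (\<lambda>x. orth_proj D x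
           + (1/2) *\<^sub>R (orth_proj (D\<^sup>\<bottom>) x - R (orth_proj (D\<^sup>\<bottom>) x))))
     \<and> (sv_scale 2 (resolvent (sv_of (\<lambda>x. 2 *\<^sub>R T x)))
           = sv_of (\<lambda>x. (orth_proj (D\<^sup>\<bottom>) x - R (orth_proj (D\<^sup>\<bottom>) x))
           + 2 *\<^sub>R orth_proj D x))
     \<and> ((\<lambda>x. (orth_proj (D\<^sup>\<bottom>) x - R (orth_proj (D\<^sup>\<bottom>) x)) + 2 *\<^sub>R orth_proj D x)
           = (\<lambda>x. x - R x + 2 *\<^sub>R orth_proj D x))
     \<and> (sv_inv (sv_of (\<lambda>x. (1/2) *\<^sub>R x + T x))
           = sv_scale 2 (resolvent (sv_of (\<lambda>x. 2 *\<^sub>R T x)))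
           \<and> sv_scale 2 (resolvent (sv_of (\<lambda>x. 2 *\<^sub>R T x)))
           = sv_of (\<lambda>x. (orth_proj (D\<^sup>\<bottom>) x - R (orth_proj (D\<^sup>\<bottom>) x))
           + 2 *\<^sub>R orth_proj D x)
           \<and> sv_of (\<lambda>x. (orth_proj (D\<^sup>\<bottom>) x - R (orth_proj (D\<^sup>\<bottom>) x))
           + 2 *\<^sub>R orth_proj D x)
           = sv_of (\<lambda>x. x - R x + 2 *\<^sub>R orth_proj D x))
     \<and> (\<forall>y\<in>D\<^sup>\<bottom>. sv_inv (sv_of (\<lambda>x. (1/2) *\<^sub>R x + T x)) y = {y - R y})"
proof -
  have "norm (R x) \<le> norm x" for x
    using nonexp[of x 0] lin by (simp add: linear_0)
  then interpret N: nonexpansive_linear_closed_range R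
    by (intro nonexpansive_linear_closed_range.intro nonexpansive_linear.intro
        nonexpansive_linear_closed_range_axioms.intro lin ran)
  have D_eq: "N.D = D" by (simp add: N.D_def D)
  note T_op = N.T_op_eq[unfolded D_eq]
  have T_eq: "T = (\<lambda>x. N.S x - (1/2) *\<^sub>R orth_proj (D\<^sup>\<bottom>) x)"
    unfolding T T_op by (simp add: sv_map_def sv_of_def)
  have half: "(\<lambda>x. (1/2) *\<^sub>R x + T x) = (\<lambda>x. N.S x + (1/2) *\<^sub>R orth_proj D x)"
    unfolding T_eq N.half_plus_T[unfolded D_eq] ..
  have Q_P: "(\<lambda>x. (orth_proj (D\<^sup>\<bottom>) x - R (orth_proj (D\<^sup>\<bottom>) x)) + 2 *\<^sub>R orth_proj D x)
      = (\<lambda>x. x - R x + 2 *\<^sub>R orth_proj D x)"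
    unfolding N.residual_Q[unfolded D_eq] ..
  have inv: "sv_inv (sv_of (\<lambda>x. (1/2) *\<^sub>R x + T x))
      = sv_of (\<lambda>x. x - R x + 2 *\<^sub>R orth_proj D x)"
    unfolding T_eq by (rule N.inv_half_plus_T[unfolded D_eq])
  have res: "resolvent (sv_of (\<lambda>x. 2 *\<^sub>R T x))
      = sv_of (\<lambda>x. orth_proj D x
          + (1/2) *\<^sub>R (orth_proj (D\<^sup>\<bottom>) x - R (orth_proj (D\<^sup>\<bottom>) x)))"
    unfolding T_eq by (rule N.resolvent_2T[unfolded D_eq])
  have res2: "sv_scale 2 (resolvent (sv_of (\<lambda>x. 2 *\<^sub>R T x)))
      = sv_of (\<lambda>x. x - R x + 2 *\<^sub>R orth_proj D x)"
    unfolding res N.residual_plus_proj[unfolded D_eq] by (simp add: sv_scale_of)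
  have comp: "sv_of (\<lambda>x. 2 *\<^sub>R T x + x)
      = sv_add (sv_scale 2 (compressed_inv D R)) (sv_of (orth_proj D))"
    unfolding N.compressed_inv_eq[unfolded D_eq] T_eq
    by (simp add: sv_add_of sv_scale_of N.P_eq[unfolded D_eq] algebra_simps)
  \<comment> \<open>On \<open>D\<^sup>\<bottom>\<close> the projection term of the inverse formula
    \<open>inv\<close> vanishes, which leaves only the residual.\<close>
  have "orth_proj D y = 0" if "y \<in> D\<^sup>\<bottom>" for y
    using N.proj_eqI(2)[of y y] that N.subspace_D by (simp add: D_eq subspace_0)
  then have "\<forall>y\<in>D\<^sup>\<bottom>. sv_inv (sv_of (\<lambda>x. (1/2) *\<^sub>R x + T x)) y = {y - R y}"
    unfolding inv by (simp add: sv_of_def)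
  moreover have "strongly_monotone (1/2) (\<lambda>x. (1/2) *\<^sub>R x + T x)"
    using N.strongly_monotone_S_P unfolding half by (simp add: D_eq)
  moreover have "T_op D R = sv_of T" unfolding T_op T_eq ..
  ultimately show ?thesis
    using inv res res2 comp unfolding Q_P by simp
qed

end
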